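(* Let $n\ge1$, $k>0$ and $f^n\in L^2(\Omega)$. Given $U^{n-1}\in V_h$, the discrete problem: find $U^n\in V_h$ such that $$\Big(\frac{U^n-U^{n-1}}{k},\varphi_h\Big)+\left(1+\|\nabla U^n\|^2\right)(\nabla U^n,\nabla\varphi_h)=(f^n,\varphi_h)\qquad\forall\varphi_h\in V_h$$ has a unique solution $U^n$.
   Context: $\Omega\subset\mathbb{R}^d$ ($d=2$ or $3$) is a bounded convex polygonal or polyhedral domain; $(\cdot,\cdot)$ and $\|\cdot\|$ are the $L^2(\Omega)$ inner product and norm. $\mathcal{T}_h$ is a regular triangulation of $\overline\Omega$ and $V_h=\{v_h\in C^0(\overline\Omega): v_h|_K\in\mathcal{P}_1(K)\ \forall K\in\mathcal{T}_h,\ v_h=0\text{ on }\partial\Omega\}$. Here $k$ is the time step, $t_n=nk$, and $f^n=f(t_n)$. *)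

theory Defs
  imports "HOL-Analysis.Analysis"
begin

section \<open>The space $L^2(\Omega)$\<close>

definition L2_space :: "'a::euclidean_space set \<Rightarrow> ('a \<Rightarrow> 'b::euclidean_space) set" where
  "L2_space \<Omega> = {u. u \<in> borel_measurable (lebesgue_on \<Omega>) \<and>
                      integrable (lebesgue_on \<Omega>) (\<lambda>x. (norm (u x))\<^sup>2)}"

text \<open>The codomain is \<open>real\<close> for scalar functions and \<open>real ^ 'd\<close> for gradients.\<close>

definition L2_inner ::
  "'a::euclidean_space set \<Rightarrow> ('a \<Rightarrow> 'b::euclidean_space) \<Rightarrow> ('a \<Rightarrow> 'b) \<Rightarrow> real" where
  "L2_inner \<Omega> u v = integral\<^sup>L (lebesgue_on \<Omega>) (\<lambda>x. u x \<bullet> v x)"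

definition L2_norm :: "'a::euclidean_space set \<Rightarrow> ('a \<Rightarrow> 'b::euclidean_space) \<Rightarrow> real" where
  "L2_norm \<Omega> u = sqrt (L2_inner \<Omega> u u)"

section \<open>The gradient\<close>

text \<open>
  The pointwise gradient, with value 0 where the function is not differentiable.
  A finite element function is affine on each mesh cell, so the default value is taken only
  on a subset of the cell boundaries, a null set that no integral sees; since the
  function is also continuous, its pointwise gradient represents its weak gradient.
\<close>

definition grad :: "('a::euclidean_space \<Rightarrow> real) \<Rightarrow> 'a \<Rightarrow> 'a" where
  "grad u x = (if \<exists>D. GDERIV u x :> D then THE D. GDERIV u x :> D else 0)"

lemma grad_eqI:
  assumes "GDERIV u x :> D"
  shows "grad u x = D"
proof -
  have "D' = D" if "GDERIV u x :> D'" for D'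
    using has_derivative_unique[OF that[unfolded gderiv_def] assms[unfolded gderiv_def]]
    by (metis vector_eq_ldot)
  with assms show ?thesis
    unfolding grad_def by (metis the_equality)
qed

section \<open>Domain, mesh and finite element space\<close>

definition convex_polytopal_domain :: "'a::euclidean_space set \<Rightarrow> bool" where
  "convex_polytopal_domain \<Omega> \<longleftrightarrow>
     open \<Omega> \<and> \<Omega> \<noteq> {} \<and> bounded \<Omega> \<and> convex \<Omega> \<and> polytope (closure \<Omega>)"

text \<open>
  The constant \<open>triangulation\<close> gives conformity: two cells meet in a common (possibly empty) face.
  The cells here are closed and of full dimension.
\<close>

definition regular_triangulation_of :: "'a::euclidean_space set set \<Rightarrow> 'a set \<Rightarrow> bool" where
  "regular_triangulation_of \<T> S \<longleftrightarrow>
     triangulation \<T> \<and> (\<forall>K\<in>\<T>. int DIM('a) simplex K) \<and> \<Union>\<T> = S"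

definition P1_on :: "'a::euclidean_space set \<Rightarrow> ('a \<Rightarrow> real) \<Rightarrow> bool" where
  "P1_on K v \<longleftrightarrow> (\<exists>a b. \<forall>x\<in>K. v x = a \<bullet> x + b)"

lemma grad_P1_interior:
  assumes P1: "\<And>y. y \<in> K \<Longrightarrow> v y = a \<bullet> y + b" and x: "x \<in> interior K"
  shows "grad v x = a"
proof (rule grad_eqI, unfold gderiv_def)
  have "((\<lambda>y. a \<bullet> y + b) has_derivative (\<lambda>h. h \<bullet> a)) (at x)"
    by (auto intro!: derivative_eq_intros simp: inner_commute)
  then show "(v has_derivative (\<lambda>h. h \<bullet> a)) (at x)"
    by (rule has_derivative_transform_within_open[OF _ open_interior x])
       (use P1 interior_subset in force)
qed

text \<open>
  An element of $V_h$ is a function on \<open>closure \<Omega>\<close>. Functions in HOL are total, so its extension by zero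
  represents it; the last condition only fixes this representative, so that equality of
  HOL functions is equality on \<open>closure \<Omega>\<close>.
\<close>

definition P1_space :: "'a::euclidean_space set \<Rightarrow> 'a set set \<Rightarrow> ('a \<Rightarrow> real) set" where
  "P1_space \<Omega> \<T> = {v. continuous_on (closure \<Omega>) v \<and>
                        (\<forall>K\<in>\<T>. P1_on K v) \<and>
                        (\<forall>x\<in>frontier \<Omega>. v x = 0) \<and>
                        (\<forall>x. x \<notin> closure \<Omega> \<longrightarrow> v x = 0)}"

end

theory Submission
  imports Defs
begin

text \<open>
  Write \<open>M\<close> for the mass form divided by \<open>k\<close>, \<open>A\<close> for the stiffness form and \<open>l\<close> for the
  right-hand side including the contribution of the previous step. For a fixed number \<open>s \<ge> 0\<close>
  the equation \<open>M u \<phi> + (1 + s) * A u \<phi> = l \<phi>\<close> is linear and symmetric positive definite on a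
  finite-dimensional space, so it has a solution \<open>u s\<close>. The map taking \<open>s\<close> to \<open>A (u s) (u s)\<close> is
  bounded and Lipschitz, hence by the intermediate value theorem it has a fixed point, which solves
  the nonlinear problem. Uniqueness is the monotonicity of the map taking \<open>u\<close> to
  \<open>(1 + A u u) * A u\<close>.
\<close>

text \<open>Cancels one factor in energy estimates of the form
  \<open>nB v * nB v \<le> C * nB v\<close>, without a case split on whether the norm
  vanishes.\<close>

lemma le_of_mult_self_le:
  fixes x y :: real
  assumes "x * x \<le> y * x" "0 \<le> y"
  shows "x \<le> y"
proof (rule ccontr)
  assume "\<not> x \<le> y"
  then have "y * x < x * x" using assms(2) by (intro mult_strict_right_mono) auto
  then show False using assms(1) by simp
qed

section \<open>Linear and semidefinite forms on spaces of functions\<close>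

text \<open>The single combination \<open>u + c * v\<close> gives sums with \<open>c = 1\<close> and
  scalar multiples with \<open>u = 0\<close>. Forms on such a space are constrained only on
  \<open>V\<close>, because integrals are additive only for integrable arguments.\<close>

definition function_subspace :: "('a \<Rightarrow> real) set \<Rightarrow> bool" where
  "function_subspace V \<longleftrightarrow>
     (\<lambda>x. 0) \<in> V \<and> (\<forall>u\<in>V. \<forall>v\<in>V. \<forall>c. (\<lambda>x. u x + c * v x) \<in> V)"

definition linear_form :: "('a \<Rightarrow> real) set \<Rightarrow> (('a \<Rightarrow> real) \<Rightarrow> real) \<Rightarrow> bool" where
  "linear_form V l \<longleftrightarrow>
     (\<forall>u\<in>V. \<forall>v\<in>V. \<forall>c. l (\<lambda>x. u x + c * v x) = l u + c * l v)"

text \<open>Linearity in the second argument follows by symmetry. Only semidefiniteness is built in;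
  definiteness is a separate hypothesis wherever it is used.\<close>

definition psd_form ::
  "('a \<Rightarrow> real) set \<Rightarrow> (('a \<Rightarrow> real) \<Rightarrow> ('a \<Rightarrow> real) \<Rightarrow> real) \<Rightarrow> bool" where
  "psd_form V B \<longleftrightarrow>
     (\<forall>w\<in>V. linear_form V (\<lambda>u. B u w)) \<and>
     (\<forall>u\<in>V. \<forall>v\<in>V. B u v = B v u) \<and> (\<forall>u\<in>V. B u u \<ge> 0)"

lemma function_subspaceD:
  assumes "function_subspace V"
  shows "(\<lambda>x. 0) \<in> V" and "\<And>u v c. u \<in> V \<Longrightarrow> v \<in> V \<Longrightarrow> (\<lambda>x. u x + c * v x) \<in> V"
  using assms by (auto simp: function_subspace_def)

lemma linear_formD:
  "linear_form V l \<Longrightarrow> u \<in> V \<Longrightarrow> v \<in> V \<Longrightarrow> l (\<lambda>x. u x + c * v x) = l u + c * l v"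
  by (auto simp: linear_form_def)

lemma linear_form_subset: "linear_form V l \<Longrightarrow> W \<subseteq> V \<Longrightarrow> linear_form W l"
  unfolding linear_form_def by blast

lemma psd_form_subset: "psd_form V B \<Longrightarrow> W \<subseteq> V \<Longrightarrow> psd_form W B"
  unfolding psd_form_def using linear_form_subset by blast

lemma linear_form_zero:
  assumes "function_subspace V" "linear_form V l"
  shows "l (\<lambda>x. 0) = 0"
  using linear_formD[OF assms(2) function_subspaceD(1)[OF assms(1)] function_subspaceD(1)[OF assms(1)], of "-1"]
  by simp

lemma psd_formD:
  assumes "psd_form V B"
  shows "\<And>u v w c. u \<in> V \<Longrightarrow> v \<in> V \<Longrightarrow> w \<in> V \<Longrightarrow> B (\<lambda>x. u x + c * v x) w = B u w + c * B v w"
    and "\<And>u v. u \<in> V \<Longrightarrow> v \<in> V \<Longrightarrow> B u v = B v u"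
    and "\<And>u. u \<in> V \<Longrightarrow> B u u \<ge> 0"
  using assms by (auto simp: psd_form_def linear_form_def)

lemma psd_form_lin_right:
  assumes "function_subspace V" "psd_form V B" "u \<in> V" "v \<in> V" "w \<in> V"
  shows "B w (\<lambda>x. u x + c * v x) = B w u + c * B w v"
  using psd_formD(1)[OF assms(2,3,4,5)] psd_formD(2)[OF assms(2) _ assms(5)]
    function_subspaceD(2)[OF assms(1,3,4)] assms(3,4) by simp

lemma psd_form_quadratic:
  assumes "function_subspace V" "psd_form V B" "u \<in> V" "v \<in> V"
  shows "B (\<lambda>x. u x + c * v x) (\<lambda>x. u x + c * v x) = B u u + 2 * c * B u v + c\<^sup>2 * B v v"
proof -
  have z: "(\<lambda>x. u x + c * v x) \<in> V" by (rule function_subspaceD(2)[OF assms(1,3,4)])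
  show ?thesis
    unfolding psd_formD(1)[OF assms(2,3,4) z] psd_form_lin_right[OF assms(1,2,3,4,3)]
      psd_form_lin_right[OF assms(1,2,3,4,4)] psd_formD(2)[OF assms(2,4,3)]
    by (simp add: algebra_simps power2_eq_square)
qed

text \<open>The usual argument from the non-negative quadratic in \<open>c\<close>. Since
  \<open>B\<close> is only semidefinite, the case \<open>B v v = 0\<close> with \<open>v\<close>
  nonzero has to be treated on its own.\<close>

lemma psd_form_Cauchy_Schwarz:
  assumes V: "function_subspace V" and B: "psd_form V B" and u: "u \<in> V" and v: "v \<in> V"
  shows "\<bar>B u v\<bar> \<le> sqrt (B u u) * sqrt (B v v)"
proof -
  have nn: "0 \<le> B u u + 2 * c * B u v + c\<^sup>2 * B v v" for c
    using psd_form_quadratic[OF V B u v, of c] psd_formD(3)[OF B function_subspaceD(2)[OF V u v, of c]]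
    by simp
  have "(B u v)\<^sup>2 \<le> B u u * B v v"
  proof (cases "B v v = 0")
    case True
    have "B u v = 0"
    proof (rule ccontr)
      assume n: "B u v \<noteq> 0"
      \<comment> \<open>Here the quadratic degenerates to an affine function of \<open>c\<close>;
        the chosen \<open>c\<close> makes its value \<open>-1\<close>.\<close>
      have "0 \<le> B u u + 2 * (- (B u u + 1) / (2 * B u v)) * B u v"
        using nn[of "- (B u u + 1) / (2 * B u v)"] True by simp
      also have "\<dots> = -1" using n by (simp add: field_simps)
      finally show False by simp
    qed
    then show ?thesis using True by simp
  next
    case False
    then have p: "B v v > 0" using psd_formD(3)[OF B v] by simp
    \<comment> \<open>The value \<open>c = - B u v / B v v\<close> minimises the quadratic.\<close>
    have "0 \<le> B v v * (B u u + 2 * (- B u v / B v v) * B u v + (- B u v / B v v)\<^sup>2 * B v v)"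
      using nn[of "- B u v / B v v"] p by (intro mult_nonneg_nonneg) auto
    also have "\<dots> = B u u * B v v - (B u v)\<^sup>2"
      using p by (simp add: field_simps power2_eq_square)
    finally show ?thesis by simp
  qed
  then have "sqrt ((B u v)\<^sup>2) \<le> sqrt (B u u * B v v)" by (rule real_sqrt_le_mono)
  then show ?thesis by (simp add: real_sqrt_mult)
qed

lemma psd_form_add:
  assumes "psd_form V M" "psd_form V A" "c \<ge> 0"
  shows "psd_form V (\<lambda>u v. M u v + c * A u v)"
  unfolding psd_form_def linear_form_def
proof (intro conjI ballI allI)
  fix u v w d assume "w \<in> V" "u \<in> V" "v \<in> V"
  then show "M (\<lambda>x. u x + d * v x) w + c * A (\<lambda>x. u x + d * v x) w
      = M u w + c * A u w + d * (M v w + c * A v w)"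
    by (simp add: psd_formD(1)[OF assms(1)] psd_formD(1)[OF assms(2)] algebra_simps)
next
  fix u v assume "u \<in> V" "v \<in> V"
  then show "M u v + c * A u v = M v u + c * A v u"
    using psd_formD(2)[OF assms(1)] psd_formD(2)[OF assms(2)] by simp
next
  fix u assume "u \<in> V"
  then show "0 \<le> M u u + c * A u u"
    using psd_formD(3)[OF assms(1)] psd_formD(3)[OF assms(2)] assms(3) by simp
qed

section \<open>Representation of linear forms on finite-dimensional spaces\<close>

text \<open>
  Finite dimensionality enters as: an element of \<open>V\<close> is determined by its values on a finite set.
  The induction removes a point \<open>p\<close> by passing to the subspace of functions vanishing at \<open>p\<close> and
  adding back one function orthogonal to it.
\<close>

lemma Riesz_finite_determined:
  fixes V :: "('a \<Rightarrow> real) set"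
  assumes "finite P" and "function_subspace V"
    and "\<And>v. v \<in> V \<Longrightarrow> (\<forall>p\<in>P. v p = 0) \<Longrightarrow> v = (\<lambda>x. 0)"
    and "psd_form V B" and "\<And>v. v \<in> V \<Longrightarrow> B v v = 0 \<Longrightarrow> v = (\<lambda>x. 0)"
    and "linear_form V l"
  shows "\<exists>u\<in>V. \<forall>\<phi>\<in>V. B u \<phi> = l \<phi>"
  using assms
proof (induction P arbitrary: V l rule: finite_induct)
  case empty
  \<comment> \<open>With no points left, the vanishing condition is vacuous and \<open>V\<close> is
    the zero space.\<close>
  have "V = {\<lambda>x. 0}" using empty.prems(1,2) by (auto simp: function_subspace_def)
  moreover have "B (\<lambda>x. 0) (\<lambda>x. 0) = 0"
    using linear_form_zero[OF empty.prems(1), of "\<lambda>u. B u (\<lambda>x. 0)"] empty.prems(1,3)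
    by (auto simp: psd_form_def function_subspace_def)
  ultimately show ?case using linear_form_zero[OF empty.prems(1,5)] by simp
next
  case (insert p P)
  note V = insert.prems(1) and B = insert.prems(3) and l = insert.prems(5)
  define W where "W = {v \<in> V. v p = 0}"
  have WV: "W \<subseteq> V" by (auto simp: W_def)
  have W: "function_subspace W" using V by (auto simp: function_subspace_def W_def)
  have BW: "psd_form W B" by (rule psd_form_subset[OF B WV])
  \<comment> \<open>The right-hand side is kept arbitrary because two are needed: \<open>l\<close>,
    and \<open>B w\<close> for the orthogonal projection.\<close>
  have IH: "\<exists>u\<in>W. \<forall>\<phi>\<in>W. B u \<phi> = l' \<phi>" if "linear_form W l'" for l'
    using that by (intro insert.IH[OF W _ BW]) (use insert.prems(2,4) WV in \<open>auto simp: W_def\<close>)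
  have lW: "linear_form W l" by (rule linear_form_subset[OF l WV])
  obtain u where u: "u \<in> W" "\<And>\<phi>. \<phi> \<in> W \<Longrightarrow> B u \<phi> = l \<phi>" using IH[OF lW] by blast
  show ?case
  proof (cases "W = V")
    case True
    then show ?thesis using u by blast
  next
    case False
    then obtain w where w: "w \<in> V" "w p \<noteq> 0" by (auto simp: W_def)
    have "linear_form W (\<lambda>\<phi>. B w \<phi>)"
      using psd_form_lin_right[OF V B] w(1) WV by (auto simp: linear_form_def subset_iff)
    then obtain w0 where w0: "w0 \<in> W" "\<And>\<phi>. \<phi> \<in> W \<Longrightarrow> B w0 \<phi> = B w \<phi>" using IH by blast
    \<comment> \<open>\<open>w0\<close> is the \<open>B\<close>-orthogonal projection of
      \<open>w\<close> onto \<open>W\<close>, so \<open>z\<close> is orthogonal to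
      \<open>W\<close>.\<close>
    define z where "z = (\<lambda>x. w x + (-1) * w0 x)"
    have zV: "z \<in> V" unfolding z_def using function_subspaceD(2)[OF V] w(1) w0(1) WV by blast
    have zp: "z p \<noteq> 0" using w w0(1) by (simp add: z_def W_def)
    have zW: "B z \<phi> = 0" if "\<phi> \<in> W" for \<phi>
      unfolding z_def using psd_formD(1)[OF B w(1), of w0 \<phi> "-1"] w0 that WV by auto
    have zz: "B z z \<noteq> 0" using insert.prems(4)[OF zV] zp by auto
    \<comment> \<open>Since \<open>u\<close> is orthogonal to \<open>z\<close>, this coefficient
      makes \<open>B y z = l z\<close>; adding a multiple of \<open>z\<close> leaves the equations
      on \<open>W\<close> intact.\<close>
    define c where "c = l z / B z z"
    define y where "y = (\<lambda>x. u x + c * z x)"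
    have uV: "u \<in> V" using u WV by auto
    have yV: "y \<in> V" unfolding y_def using function_subspaceD(2)[OF V] zV uV by blast
    have "B y \<phi> = l \<phi>" if \<phi>: "\<phi> \<in> V" for \<phi>
    proof -
      \<comment> \<open>\<open>W\<close> is the kernel of evaluation at \<open>p\<close> and
        \<open>z p \<noteq> 0\<close>, so subtracting \<open>d * z\<close> puts
        \<open>\<phi>\<close> into \<open>W\<close>: thus \<open>V\<close> is \<open>W\<close> plus
        the multiples of \<open>z\<close>.\<close>
      define d where "d = \<phi> p / z p"
      define \<psi> where "\<psi> = (\<lambda>x. \<phi> x + (- d) * z x)"
      have \<psi>V: "\<psi> \<in> V" unfolding \<psi>_def using function_subspaceD(2)[OF V \<phi> zV] by blast
      then have \<psi>W: "\<psi> \<in> W" using zp by (simp add: W_def \<psi>_def d_def)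
      have e: "\<phi> = (\<lambda>x. \<psi> x + d * z x)" by (auto simp: \<psi>_def)
      have "B y \<phi> = B y \<psi> + d * B y z"
        by (subst e) (rule psd_form_lin_right[OF V B \<psi>V zV yV])
      also have "B y \<psi> = B u \<psi> + c * B z \<psi>" unfolding y_def by (rule psd_formD(1)[OF B uV zV \<psi>V])
      also have "B y z = B u z + c * B z z" unfolding y_def by (rule psd_formD(1)[OF B uV zV zV])
      also have "B u z = 0" using zW[OF u(1)] psd_formD(2)[OF B uV zV] by simp
      finally have "B y \<phi> = l \<psi> + d * l z" using zW[OF \<psi>W] u(2)[OF \<psi>W] zz by (simp add: c_def)
      also have "\<dots> = l \<phi>" using linear_formD[OF l \<psi>V zV, of d] e by simp
      finally show ?thesis .
    qed
    then show ?thesis using yV by blast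
  qed
qed

section \<open>Uniqueness and existence for the abstract nonlinear equation\<close>

text \<open>Both equations are tested with the difference \<open>e\<close> and subtracted. The
  nonlinear part is then non-negative, which forces \<open>M e e = 0\<close>.\<close>

lemma Kirchhoff_unique:
  assumes V: "function_subspace V" and M: "psd_form V M" and A: "psd_form V A"
    and U: "U \<in> V" "\<And>\<phi>. \<phi> \<in> V \<Longrightarrow> M U \<phi> + (1 + A U U) * A U \<phi> = l \<phi>"
    and W: "W \<in> V" "\<And>\<phi>. \<phi> \<in> V \<Longrightarrow> M W \<phi> + (1 + A W W) * A W \<phi> = l \<phi>"
    and Mdef: "\<And>v. v \<in> V \<Longrightarrow> M v v = 0 \<Longrightarrow> v = (\<lambda>x. 0)"
  shows "U = W"
proof -
  define e where "e = (\<lambda>x. U x + (-1) * W x)"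
  have eV: "e \<in> V" unfolding e_def using function_subspaceD(2)[OF V U(1) W(1)] .
  define a b m where "a = A U U" and "b = A W W" and "m = A U W"
  have Ae: "A e e = a - 2 * m + b" "A U e = a - m" "A W e = m - b"
    using psd_form_quadratic[OF V A U(1) W(1), of "-1"]
      psd_form_lin_right[OF V A U(1) W(1) U(1), of "-1"]
      psd_form_lin_right[OF V A U(1) W(1) W(1), of "-1"] psd_formD(2)[OF A W(1) U(1)]
    unfolding e_def a_def b_def m_def by simp_all
  have pos: "A e e \<ge> 0" "M e e \<ge> 0" "a \<ge> 0" "b \<ge> 0"
    using psd_formD(3) A M eV U(1) W(1) unfolding a_def b_def by blast+
  have Me: "M e e = M U e - M W e"
    using psd_formD(1)[OF M U(1) W(1) eV, of "-1"] unfolding e_def by simp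
  have "M e e + ((1 + a) * (a - m) - (1 + b) * (m - b)) = 0"
    using U(2)[OF eV] W(2)[OF eV] Ae Me unfolding a_def b_def by simp
  \<comment> \<open>Monotonicity in explicit form: symmetrising in \<open>a\<close> and
    \<open>b\<close> turns the mixed terms into \<open>A e e\<close> with non-negative weights plus
    a square.\<close>
  moreover have "(1 + a) * (a - m) - (1 + b) * (m - b)
      = A e e + (a + b) * (A e e) / 2 + (a - b)\<^sup>2 / 2"
    unfolding Ae by (simp add: field_simps power2_eq_square)
  moreover have "(a + b) * (A e e) / 2 \<ge> 0" using pos by simp
  ultimately have "M e e = 0" using pos by (smt (verit) zero_le_power2 divide_nonneg_pos)
  then have "e = (\<lambda>x. 0)" using Mdef[OF eV] by blast
  then show ?thesis unfolding e_def by (auto simp: fun_eq_iff)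
qed

lemma Kirchhoff_exists:
  fixes V :: "('a \<Rightarrow> real) set"
  assumes P: "finite P" and V: "function_subspace V"
    and det: "\<And>v. v \<in> V \<Longrightarrow> (\<forall>p\<in>P. v p = 0) \<Longrightarrow> v = (\<lambda>x. 0)"
    and M: "psd_form V M" and A: "psd_form V A"
    and Mdef: "\<And>v. v \<in> V \<Longrightarrow> M v v = 0 \<Longrightarrow> v = (\<lambda>x. 0)"
    and l: "linear_form V l"
  shows "\<exists>U\<in>V. \<forall>\<phi>\<in>V. M U \<phi> + (1 + A U U) * A U \<phi> = l \<phi>"
proof -
  have "\<exists>u\<in>V. \<forall>\<phi>\<in>V. M u \<phi> + (1 + s) * A u \<phi> = l \<phi>" if s: "s \<ge> 0" for s
  proof (rule Riesz_finite_determined[OF P V det psd_form_add[OF M A] _ l])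
    \<comment> \<open>Both summands are non-negative, so definiteness of the sum is inherited from
      \<open>M\<close>.\<close>
    fix v assume v: "v \<in> V" "M v v + (1 + s) * A v v = 0"
    moreover have "(1 + s) * A v v \<ge> 0" using psd_formD(3)[OF A v(1)] s by simp
    ultimately have "M v v = 0" using psd_formD(3)[OF M v(1)] by linarith
    then show "v = (\<lambda>x. 0)" using Mdef v by blast
  qed (use s in auto)
  then obtain u where uV: "\<And>s. s \<ge> 0 \<Longrightarrow> u s \<in> V"
    and u: "\<And>s \<phi>. s \<ge> 0 \<Longrightarrow> \<phi> \<in> V \<Longrightarrow> M (u s) \<phi> + (1 + s) * A (u s) \<phi> = l \<phi>"
    by metis
  \<comment> \<open>The form of the linear problem at \<open>s = 0\<close>. It dominates
    \<open>A\<close> and lies below the form for every \<open>s \<ge> 0\<close>, so its norm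
    \<open>nB\<close> gives estimates uniform in \<open>s\<close>.\<close>
  define B where "B = (\<lambda>u v. M u v + 1 * A u v)"
  have B: "psd_form V B" unfolding B_def by (rule psd_form_add[OF M A]) simp
  define nB where "nB v = sqrt (B v v)" for v
  have nB0: "nB v \<ge> 0" and nB2: "nB v * nB v = B v v" if "v \<in> V" for v
    using psd_formD(3)[OF B that] by (auto simp: nB_def)
  have ABle: "A v v \<le> B v v" if "v \<in> V" for v
    using psd_formD(3)[OF M that] by (simp add: B_def)
  have CSA: "\<bar>A v w\<bar> \<le> nB v * nB w" if "v \<in> V" "w \<in> V" for v w
  proof -
    have "\<bar>A v w\<bar> \<le> sqrt (A v v) * sqrt (A w w)" by (rule psd_form_Cauchy_Schwarz[OF V A that])
    also have "\<dots> \<le> nB v * nB w" unfolding nB_def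
      using psd_formD(3)[OF A that(2)] psd_formD(3)[OF B that(1)] ABle[OF that(1)] ABle[OF that(2)]
      by (intro mult_mono real_sqrt_le_mono real_sqrt_ge_zero) auto
    finally show ?thesis .
  qed
  \<comment> \<open>As \<open>u 0\<close> represents \<open>l\<close> with respect to
    \<open>B\<close>, this is the dual norm of \<open>l\<close>. Testing the equation for
    \<open>s\<close> with \<open>u s\<close> itself bounds every \<open>u s\<close> by it.\<close>
  define R where "R = nB (u 0)"
  have R0: "R \<ge> 0" unfolding R_def by (rule nB0[OF uV]) simp
  have uR: "nB (u s) \<le> R" if s: "s \<ge> 0" for s
  proof -
    have "nB (u s) * nB (u s) = B (u s) (u s)" by (rule nB2[OF uV[OF s]])
    also have "\<dots> \<le> M (u s) (u s) + (1 + s) * A (u s) (u s)"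
      using psd_formD(3)[OF A uV[OF s]] s by (simp add: B_def algebra_simps)
    also have "\<dots> = B (u 0) (u s)" using u[OF s uV[OF s]] u[of 0, OF _ uV[OF s]] by (simp add: B_def)
    also have "\<dots> \<le> R * nB (u s)"
      using psd_form_Cauchy_Schwarz[OF V B uV uV[OF s], of 0] unfolding nB_def R_def by simp
    finally show ?thesis using R0
      by (rule le_of_mult_self_le)
  qed
  have lip: "\<bar>A (u s) (u s) - A (u t) (u t)\<bar> \<le> 2 * R\<^sup>2 * \<bar>s - t\<bar>" if s: "s \<ge> 0" and t: "t \<ge> 0" for s t
  proof -
    define e where "e = (\<lambda>x. u s x + (-1) * u t x)"
    note us = uV[OF s] and ut = uV[OF t]
    have eV: "e \<in> V" unfolding e_def using function_subspaceD(2)[OF V us ut] .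
    have "nB e * nB e = B e e" by (rule nB2[OF eV])
    also have "\<dots> \<le> M e e + (1 + s) * A e e"
      using psd_formD(3)[OF A eV] s by (simp add: B_def algebra_simps)
    \<comment> \<open>The two equations have the same right-hand side; after subtraction only the
      change of the coefficient remains.\<close>
    also have "\<dots> = (t - s) * A (u t) e"
    proof -
      have d: "M e e = M (u s) e - M (u t) e" "A e e = A (u s) e - A (u t) e"
        using psd_formD(1)[OF M us ut eV, of "-1"] psd_formD(1)[OF A us ut eV, of "-1"]
        unfolding e_def by simp_all
      show ?thesis using u[OF s eV] u[OF t eV] unfolding d by (simp add: algebra_simps)
    qed
    also have "\<dots> \<le> \<bar>t - s\<bar> * \<bar>A (u t) e\<bar>" unfolding abs_mult[symmetric] by (rule abs_ge_self)
    also have "\<dots> \<le> \<bar>t - s\<bar> * (R * nB e)"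
      by (intro mult_left_mono order_trans[OF CSA[OF ut eV]] mult_right_mono uR t nB0 eV) simp
    finally have "nB e * nB e \<le> (\<bar>s - t\<bar> * R) * nB e" by (simp add: abs_minus_commute)
    then have e: "nB e \<le> \<bar>s - t\<bar> * R" by (rule le_of_mult_self_le) (use R0 in simp)
    \<comment> \<open>The difference of two squares, factored as \<open>A e\<close> applied to the
      sum of \<open>u s\<close> and \<open>u t\<close>.\<close>
    have "A (u s) (u s) - A (u t) (u t) = A e (u s) + A e (u t)"
      using psd_formD(1)[OF A us ut us, of "-1"] psd_formD(1)[OF A us ut ut, of "-1"]
        psd_formD(2)[OF A us ut] unfolding e_def by simp
    then have "\<bar>A (u s) (u s) - A (u t) (u t)\<bar> \<le> nB e * nB (u s) + nB e * nB (u t)"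
      using CSA[OF eV us] CSA[OF eV ut] by linarith
    also have "\<dots> \<le> (\<bar>s - t\<bar> * R) * R + (\<bar>s - t\<bar> * R) * R"
      using e uR[OF s] uR[OF t] nB0[OF us] nB0[OF ut] R0 by (intro add_mono mult_mono) auto
    finally show ?thesis by (simp add: power2_eq_square algebra_simps)
  qed
  have "continuous_on {0..R\<^sup>2} (\<lambda>s. A (u s) (u s))"
  proof (rule lipschitz_on_continuous_on)
    show "(2 * R\<^sup>2)-lipschitz_on {0..R\<^sup>2} (\<lambda>s. A (u s) (u s))"
      using lip by (intro lipschitz_onI) (auto simp: dist_real_def)
  qed
  then have "continuous_on {0..R\<^sup>2} (\<lambda>s. s - A (u s) (u s))" by (intro continuous_intros)
  \<comment> \<open>This is the sign of \<open>s - A (u s) (u s)\<close> at the right end point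
    \<open>R\<^sup>2\<close>; at \<open>0\<close> the sign is opposite because \<open>A\<close> is
    non-negative.\<close>
  moreover have "A (u (R\<^sup>2)) (u (R\<^sup>2)) \<le> R\<^sup>2"
  proof -
    have "A (u (R\<^sup>2)) (u (R\<^sup>2)) \<le> nB (u (R\<^sup>2)) * nB (u (R\<^sup>2))"
      using ABle[OF uV[of "R\<^sup>2"]] nB2[OF uV[of "R\<^sup>2"]] by simp
    also have "\<dots> \<le> R * R"
      using uR[of "R\<^sup>2"] nB0[OF uV[of "R\<^sup>2"]] R0 by (intro mult_mono) auto
    finally show ?thesis by (simp add: power2_eq_square)
  qed
  ultimately obtain s where "0 \<le> s" "s - A (u s) (u s) = 0"
    using IVT'[of "\<lambda>s. s - A (u s) (u s)" 0 0 "R\<^sup>2"] psd_formD(3)[OF A uV[of 0]] by auto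
  then have "\<forall>\<phi>\<in>V. M (u s) \<phi> + (1 + A (u s) (u s)) * A (u s) \<phi> = l \<phi>"
    using u[of s] by simp
  then show ?thesis using uV[OF \<open>0 \<le> s\<close>] by blast
qed

section \<open>Integrability of products and the form \<open>L2_inner\<close>\<close>

text \<open>Membership in the space of essentially bounded functions. The bound is only almost
  everywhere because gradients are controlled only in the cell interiors.\<close>

definition bounded_measurable :: "'a::euclidean_space set \<Rightarrow> ('a \<Rightarrow> 'b::euclidean_space) \<Rightarrow> bool" where
  "bounded_measurable \<Omega> g \<longleftrightarrow>
     g \<in> borel_measurable (lebesgue_on \<Omega>) \<and> (\<exists>C. AE x in lebesgue_on \<Omega>. norm (g x) \<le> C)"

lemma bounded_measurable_integrable_inner:
  assumes "\<Omega> \<in> lmeasurable" "bounded_measurable \<Omega> u" "bounded_measurable \<Omega> v"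
  shows "integrable (lebesgue_on \<Omega>) (\<lambda>x. u x \<bullet> v x)"
proof -
  interpret finite_measure "lebesgue_on \<Omega>" by (rule finite_measure_lebesgue_on[OF assms(1)])
  obtain C D where CD: "AE x in lebesgue_on \<Omega>. norm (u x) \<le> C" "AE x in lebesgue_on \<Omega>. norm (v x) \<le> D"
    using assms(2,3) by (auto simp: bounded_measurable_def)
  have [measurable]: "u \<in> borel_measurable (lebesgue_on \<Omega>)" "v \<in> borel_measurable (lebesgue_on \<Omega>)"
    using assms(2,3) by (auto simp: bounded_measurable_def)
  show ?thesis
  proof (rule integrable_const_bound)
    show "AE x in lebesgue_on \<Omega>. norm (u x \<bullet> v x) \<le> C * D"
      using CD
    proof eventually_elim
      case (elim x)
      have "norm (u x \<bullet> v x) \<le> norm (u x) * norm (v x)" by (simp add: Cauchy_Schwarz_ineq2)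
      also have "\<dots> \<le> C * D" using elim by (intro mult_mono) (auto intro: order_trans[OF norm_ge_zero])
      finally show ?case .
    qed
  qed measurable
qed

text \<open>The product is dominated by \<open>(norm (f x))\<^sup>2 + D\<^sup>2\<close>, and
  constants are integrable because the domain has finite measure.\<close>

lemma L2_space_integrable_inner:
  assumes "\<Omega> \<in> lmeasurable" "f \<in> L2_space \<Omega>" "bounded_measurable \<Omega> v"
  shows "integrable (lebesgue_on \<Omega>) (\<lambda>x. f x \<bullet> v x)"
proof -
  interpret finite_measure "lebesgue_on \<Omega>" by (rule finite_measure_lebesgue_on[OF assms(1)])
  obtain D where D: "AE x in lebesgue_on \<Omega>. norm (v x) \<le> D"
    using assms(3) by (auto simp: bounded_measurable_def)
  have [measurable]: "f \<in> borel_measurable (lebesgue_on \<Omega>)" "v \<in> borel_measurable (lebesgue_on \<Omega>)"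
    and fi: "integrable (lebesgue_on \<Omega>) (\<lambda>x. (norm (f x))\<^sup>2)"
    using assms(2,3) by (auto simp: bounded_measurable_def L2_space_def)
  show ?thesis
  proof (rule Bochner_Integration.integrable_bound)
    show "integrable (lebesgue_on \<Omega>) (\<lambda>x. (norm (f x))\<^sup>2 + D\<^sup>2)" using fi by simp
    show "AE x in lebesgue_on \<Omega>. norm (f x \<bullet> v x) \<le> norm ((norm (f x))\<^sup>2 + D\<^sup>2)"
      using D
    proof eventually_elim
      case (elim x)
      have D0: "0 \<le> D" by (rule order_trans[OF norm_ge_zero elim])
      have "norm (f x \<bullet> v x) \<le> norm (f x) * norm (v x)" by (simp add: Cauchy_Schwarz_ineq2)
      also have "\<dots> \<le> norm (f x) * D" using elim by (intro mult_left_mono) auto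
      also have "\<dots> \<le> (norm (f x))\<^sup>2 + D\<^sup>2"
        using sum_squares_bound[of "norm (f x)" D] mult_nonneg_nonneg[OF norm_ge_zero[of "f x"] D0]
        by linarith
      finally show ?case by simp
    qed
  qed measurable
qed

lemma L2_inner_commute: "L2_inner \<Omega> u v = L2_inner \<Omega> v u"
  by (simp add: L2_inner_def inner_commute)

lemma L2_inner_nonneg: "0 \<le> L2_inner \<Omega> u u"
  unfolding L2_inner_def by (rule Bochner_Integration.integral_nonneg) simp

lemma L2_norm_power2: "(L2_norm \<Omega> u)\<^sup>2 = L2_inner \<Omega> u u"
  by (simp add: L2_norm_def L2_inner_nonneg)

text \<open>The vector-valued form serves both scalar functions and gradients.\<close>

lemma L2_inner_add_scaleR_left:
  assumes "integrable (lebesgue_on \<Omega>) (\<lambda>x. u x \<bullet> w x)" "integrable (lebesgue_on \<Omega>) (\<lambda>x. v x \<bullet> w x)"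
  shows "L2_inner \<Omega> (\<lambda>x. u x + c *\<^sub>R v x) w = L2_inner \<Omega> u w + c * L2_inner \<Omega> v w"
  using assms by (simp add: L2_inner_def inner_add_left)

section \<open>The finite element space and its gradients\<close>

lemma function_subspace_P1_space:
  fixes \<Omega> :: "'a::euclidean_space set"
  shows "function_subspace (P1_space \<Omega> \<T>)"
proof -
  have "P1_on K (\<lambda>x. u x + c * v x)" if uv: "P1_on K u" "P1_on K v" for K :: "'a set" and u v c
  proof -
    obtain a b a' b' where ab: "\<forall>x\<in>K. u x = a \<bullet> x + b" "\<forall>x\<in>K. v x = a' \<bullet> x + b'"
      using uv unfolding P1_on_def by blast
    have "\<forall>x\<in>K. u x + c * v x = (a + c *\<^sub>R a') \<bullet> x + (b + c * b')"
      using ab by (simp add: algebra_simps)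
    then show ?thesis unfolding P1_on_def by blast
  qed
  moreover have "P1_on K (\<lambda>x. 0)" for K :: "'a set"
    unfolding P1_on_def by (intro exI[of _ 0]) simp
  ultimately show ?thesis
    unfolding function_subspace_def P1_space_def by (auto intro!: continuous_intros)
qed

text \<open>The finite set consists of the vertices of all cells. On a cell the zero set of an
  affine function is convex, so vanishing at the vertices spreads to their hull.\<close>

lemma P1_space_determined:
  fixes \<Omega> :: "'a::euclidean_space set"
  assumes "regular_triangulation_of \<T> (closure \<Omega>)"
  shows "\<exists>P. finite P \<and> (\<forall>v\<in>P1_space \<Omega> \<T>. (\<forall>p\<in>P. v p = 0) \<longrightarrow> v = (\<lambda>x. 0))"
proof -
  have \<T>: "finite \<T>" "\<Union>\<T> = closure \<Omega>"
    and simp\<T>: "\<forall>K\<in>\<T>. int DIM('a) simplex K"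
    using assms by (simp_all add: regular_triangulation_of_def triangulation_def)
  have "\<exists>C. finite C \<and> K = convex hull C" if "K \<in> \<T>" for K
    using simp\<T> that by (meson simplex)
  then obtain C where C: "\<And>K. K \<in> \<T> \<Longrightarrow> finite (C K)" "\<And>K. K \<in> \<T> \<Longrightarrow> K = convex hull (C K)"
    by metis
  have "v = (\<lambda>x. 0)" if v: "v \<in> P1_space \<Omega> \<T>" "\<forall>p\<in>(\<Union>K\<in>\<T>. C K). v p = 0" for v
  proof
    fix x
    show "v x = 0"
    proof (cases "x \<in> closure \<Omega>")
      case False
      then show ?thesis using v by (auto simp: P1_space_def)
    next
      case True
      then obtain K where K: "K \<in> \<T>" "x \<in> K" using \<T> by blast
      then have "P1_on K v" using v(1) by (simp add: P1_space_def)
      then obtain a b where ab: "\<forall>x\<in>K. v x = a \<bullet> x + b" unfolding P1_on_def by blast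
      have "C K \<subseteq> K" by (subst (2) C(2)[OF K(1)]) (rule hull_subset)
      then have "C K \<subseteq> {x. a \<bullet> x = - b}" using ab v(2) K(1) by force
      then have "convex hull C K \<subseteq> {x. a \<bullet> x = - b}" by (rule hull_minimal) (rule convex_hyperplane)
      then show ?thesis using C(2)[OF K(1)] K(2) ab by auto
    qed
  qed
  moreover have "finite (\<Union>K\<in>\<T>. C K)" using \<T> C by blast
  ultimately show ?thesis by blast
qed

lemma P1_space_bounded_measurable:
  assumes "open \<Omega>" "bounded \<Omega>" "v \<in> P1_space \<Omega> \<T>"
  shows "bounded_measurable \<Omega> v"
proof -
  have c: "continuous_on (closure \<Omega>) v" using assms by (simp add: P1_space_def)
  have "continuous_on \<Omega> v" by (rule continuous_on_subset[OF c closure_subset])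
  then have "v \<in> borel_measurable (lebesgue_on \<Omega>)"
    by (rule continuous_imp_measurable_on_sets_lebesgue) (use assms in auto)
  moreover have "bounded (v ` closure \<Omega>)"
    using compact_continuous_image[OF c] assms(2) by (simp add: compact_imp_bounded)
  then obtain C where "\<forall>x\<in>closure \<Omega>. norm (v x) \<le> C" by (auto simp: bounded_iff)
  then have "\<forall>x\<in>\<Omega>. norm (v x) \<le> C" by (auto dest: subsetD[OF closure_subset])
  then have "AE x in lebesgue_on \<Omega>. norm (v x) \<le> C" by (intro AE_I2) simp
  ultimately show ?thesis unfolding bounded_measurable_def by blast
qed

text \<open>A zero integral gives \<open>v = 0\<close> almost everywhere. The zero set is closed by
  continuity, hence contains the open set \<open>\<Omega>\<close>; on the frontier and outside,
  \<open>v\<close> vanishes by definition of the space.\<close>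

lemma P1_space_L2_definite:
  assumes \<Omega>: "open \<Omega>" "bounded \<Omega>" and v: "v \<in> P1_space \<Omega> \<T>" and 0: "L2_inner \<Omega> v v = 0"
  shows "v = (\<lambda>x. 0)"
proof -
  have lm: "\<Omega> \<in> lmeasurable" using \<Omega> by (rule lmeasurable_open[rotated])
  note bm = P1_space_bounded_measurable[OF \<Omega> v]
  have "AE x in lebesgue_on \<Omega>. v x \<bullet> v x = 0"
    using 0 integral_nonneg_eq_0_iff_AE[OF bounded_measurable_integrable_inner[OF lm bm bm]]
    by (simp add: L2_inner_def)
  then have ae: "AE x \<in> \<Omega> in lebesgue. v x = 0"
    using \<Omega>(1) by (simp add: AE_restrict_space_iff)
  have cl: "closed {x \<in> closure \<Omega>. v x = 0}"
    using v by (intro continuous_closed_preimage_constant) (auto simp: P1_space_def)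
  have "AE x \<in> \<Omega> in lebesgue. x \<in> {x \<in> closure \<Omega>. v x = 0}"
    using ae closure_subset by (auto elim!: eventually_mono)
  then have "v x = 0" if "x \<in> \<Omega>" for x
    using mem_closed_if_AE_lebesgue_open[OF \<Omega>(1) cl _ that] by simp
  then show ?thesis using v \<Omega>(1) by (auto simp: P1_space_def frontier_def interior_open fun_eq_iff)
qed

text \<open>The cells cover \<open>\<Omega>\<close>, and the exceptional points lie on finitely many
  frontiers of convex sets, which are negligible.\<close>

lemma AE_interior_cell:
  fixes \<Omega> :: "'a::euclidean_space set"
  assumes "open \<Omega>" "regular_triangulation_of \<T> (closure \<Omega>)"
  shows "AE x \<in> \<Omega> in lebesgue. x \<in> (\<Union>K\<in>\<T>. interior K)"
proof -
  have \<T>: "finite \<T>" "\<Union>\<T> = closure \<Omega>"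
    and simp\<T>: "\<forall>K\<in>\<T>. int DIM('a) simplex K"
    using assms(2) by (simp_all add: regular_triangulation_of_def triangulation_def)
  have conv: "convex K" if "K \<in> \<T>" for K
    by (rule convex_simplex[OF bspec[OF simp\<T> that]])
  have "negligible (\<Union>K\<in>\<T>. frontier K)"
    by (intro negligible_Union finite_imageI \<T>(1)) (auto intro: negligible_convex_frontier conv)
  then have "(\<Union>K\<in>\<T>. frontier K) \<in> null_sets lebesgue" by (simp add: negligible_iff_null_sets)
  then show ?thesis
  proof (rule AE_I')
    show "{x \<in> space lebesgue. \<not> (x \<in> \<Omega> \<longrightarrow> x \<in> (\<Union>K\<in>\<T>. interior K))} \<subseteq> (\<Union>K\<in>\<T>. frontier K)"
    proof
      fix x assume "x \<in> {x \<in> space lebesgue. \<not> (x \<in> \<Omega> \<longrightarrow> x \<in> (\<Union>K\<in>\<T>. interior K))}"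
      then have x: "x \<in> \<Omega>" "x \<notin> (\<Union>K\<in>\<T>. interior K)" by auto
      then have "x \<in> \<Union>\<T>" unfolding \<T>(2) by (simp add: subsetD[OF closure_subset])
      then obtain K where "K \<in> \<T>" "x \<in> K" by blast
      then show "x \<in> (\<Union>K\<in>\<T>. frontier K)"
        using x(2) subsetD[OF closure_subset[of K]] by (auto simp: frontier_def)
    qed
  qed
qed

lemma grad_P1_on_interior:
  assumes "P1_on K v"
  shows "\<exists>a. \<forall>x\<in>interior K. grad v x = a"
  using assms grad_P1_interior unfolding P1_on_def by metis

text \<open>Restricted to cell interiors because elsewhere the default value 0 of
  \<open>grad\<close> can break additivity.\<close>

lemma grad_P1_on_add:
  assumes "P1_on K u" "P1_on K v" "x \<in> interior K"
  shows "grad (\<lambda>x. u x + c * v x) x = grad u x + c *\<^sub>R grad v x"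
proof -
  obtain a b a' b' where ab: "\<And>x. x \<in> K \<Longrightarrow> u x = a \<bullet> x + b" "\<And>x. x \<in> K \<Longrightarrow> v x = a' \<bullet> x + b'"
    using assms by (auto simp: P1_on_def)
  have "u x + c * v x = (a + c *\<^sub>R a') \<bullet> x + (b + c * b')" if "x \<in> K" for x
    using ab that by (simp add: algebra_simps)
  from grad_P1_interior[OF this assms(3)] show ?thesis
    using grad_P1_interior[OF ab(1) assms(3)] grad_P1_interior[OF ab(2) assms(3)] by simp
qed

text \<open>The gradient is constant on each cell interior, hence continuous on the open union
  \<open>G\<close> of the interiors, which fills \<open>\<Omega>\<close> up to a null set.\<close>

lemma P1_space_grad_bounded_measurable:
  assumes \<Omega>: "open \<Omega>" and \<T>: "regular_triangulation_of \<T> (closure \<Omega>)" and v: "v \<in> P1_space \<Omega> \<T>"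
  shows "bounded_measurable \<Omega> (grad v)"
proof -
  define G where "G = (\<Union>K\<in>\<T>. interior K)"
  have ae: "AE x \<in> \<Omega> in lebesgue. x \<in> G" unfolding G_def by (rule AE_interior_cell[OF \<Omega> \<T>])
  have "\<forall>K\<in>\<T>. \<exists>a. \<forall>x\<in>interior K. grad v x = a"
    using v grad_P1_on_interior by (auto simp: P1_space_def)
  then obtain a where a: "\<And>K x. K \<in> \<T> \<Longrightarrow> x \<in> interior K \<Longrightarrow> grad v x = a K" by metis
  have "continuous_on G (grad v)" unfolding G_def
  proof (rule continuous_on_open_UN)
    fix K assume "K \<in> \<T>"
    then show "continuous_on (interior K) (grad v)"
      using a by (subst continuous_on_cong[OF refl, of _ _ "\<lambda>_. a K"]) auto
  qed auto
  then have "continuous_on (\<Omega> \<inter> G) (grad v)" by (rule continuous_on_subset) simp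
  moreover have oG: "open (\<Omega> \<inter> G)" using \<Omega> by (auto simp: G_def)
  ultimately have "grad v \<in> borel_measurable (lebesgue_on (\<Omega> \<inter> G))"
    by (intro continuous_imp_measurable_on_sets_lebesgue) auto
  \<comment> \<open>Extension by zero moves the claim to Lebesgue measure on the whole space, where
    changing a function on a null set preserves measurability.\<close>
  then have "(\<lambda>x. if x \<in> \<Omega> \<inter> G then grad v x else 0) \<in> borel_measurable lebesgue"
    using oG by (subst borel_measurable_if) auto
  then have "(\<lambda>x. if x \<in> \<Omega> then grad v x else 0) \<in> borel_measurable lebesgue"
    by (rule borel_measurable_AE) (use ae in \<open>auto elim!: eventually_mono\<close>)
  then have "grad v \<in> borel_measurable (lebesgue_on \<Omega>)"
    using \<Omega> by (subst (asm) borel_measurable_if) auto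
  \<comment> \<open>The sum over the finitely many cells is a crude bound for each single value
    \<open>a K\<close>.\<close>
  moreover have "AE x \<in> \<Omega> in lebesgue. norm (grad v x) \<le> (\<Sum>K\<in>\<T>. norm (a K))"
    using ae
  proof (rule eventually_mono, intro impI)
    fix x assume "x \<in> \<Omega> \<longrightarrow> x \<in> G" "x \<in> \<Omega>"
    then obtain K where "K \<in> \<T>" "grad v x = a K" using a unfolding G_def by blast
    moreover have "finite \<T>" using \<T> by (simp add: regular_triangulation_of_def triangulation_def)
    ultimately show "norm (grad v x) \<le> (\<Sum>K\<in>\<T>. norm (a K))"
      using member_le_sum[of K \<T> "\<lambda>K. norm (a K)"] by simp
  qed
  then have "AE x in lebesgue_on \<Omega>. norm (grad v x) \<le> (\<Sum>K\<in>\<T>. norm (a K))"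
    using \<Omega> by (simp add: AE_restrict_space_iff)
  ultimately show ?thesis unfolding bounded_measurable_def by blast
qed

section \<open>Mass form, stiffness form and load functional\<close>

lemma psd_form_L2_inner:
  assumes \<Omega>: "open \<Omega>" "bounded \<Omega>"
  shows "psd_form (P1_space \<Omega> \<T>) (L2_inner \<Omega>)"
proof -
  have lm: "\<Omega> \<in> lmeasurable" using \<Omega> by (rule lmeasurable_open[rotated])
  have "L2_inner \<Omega> (\<lambda>x. u x + c * v x) w = L2_inner \<Omega> u w + c * L2_inner \<Omega> v w"
    if "u \<in> P1_space \<Omega> \<T>" "v \<in> P1_space \<Omega> \<T>" "w \<in> P1_space \<Omega> \<T>" for u v w c
    by (rule L2_inner_add_scaleR_left[of \<Omega> u w v c, unfolded real_scaleR_def])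
      (intro bounded_measurable_integrable_inner[OF lm] P1_space_bounded_measurable[OF \<Omega>, of _ \<T>] that)+
  then show ?thesis
    unfolding psd_form_def linear_form_def using L2_inner_commute L2_inner_nonneg by blast
qed

text \<open>\<open>grad\<close> is linear only in the cell interiors, that is almost everywhere;
  this suffices under the integral.\<close>

lemma psd_form_L2_inner_grad:
  assumes \<Omega>: "open \<Omega>" "bounded \<Omega>" and \<T>: "regular_triangulation_of \<T> (closure \<Omega>)"
  shows "psd_form (P1_space \<Omega> \<T>) (\<lambda>u v. L2_inner \<Omega> (grad u) (grad v))"
proof -
  have lm: "\<Omega> \<in> lmeasurable" using \<Omega> by (rule lmeasurable_open[rotated])
  note bm = P1_space_grad_bounded_measurable[OF \<Omega>(1) \<T>]
  have "L2_inner \<Omega> (grad (\<lambda>x. u x + c * v x)) (grad w)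
      = L2_inner \<Omega> (grad u) (grad w) + c * L2_inner \<Omega> (grad v) (grad w)"
    if u: "u \<in> P1_space \<Omega> \<T>" and v: "v \<in> P1_space \<Omega> \<T>" and w: "w \<in> P1_space \<Omega> \<T>" for u v w c
  proof -
    have uv: "(\<lambda>x. u x + c * v x) \<in> P1_space \<Omega> \<T>"
      by (rule function_subspaceD(2)[OF function_subspace_P1_space u v])
    have [measurable]: "grad u \<in> borel_measurable (lebesgue_on \<Omega>)"
      "grad v \<in> borel_measurable (lebesgue_on \<Omega>)" "grad w \<in> borel_measurable (lebesgue_on \<Omega>)"
      "grad (\<lambda>x. u x + c * v x) \<in> borel_measurable (lebesgue_on \<Omega>)"
      using bm[OF u] bm[OF v] bm[OF w] bm[OF uv] by (auto simp: bounded_measurable_def)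
    have "AE x \<in> \<Omega> in lebesgue. grad (\<lambda>x. u x + c * v x) x = grad u x + c *\<^sub>R grad v x"
      using AE_interior_cell[OF \<Omega>(1) \<T>]
    proof (rule eventually_mono, intro impI)
      fix x assume "x \<in> \<Omega> \<longrightarrow> x \<in> (\<Union>K\<in>\<T>. interior K)" "x \<in> \<Omega>"
      then obtain K where K: "K \<in> \<T>" "x \<in> interior K" by blast
      then show "grad (\<lambda>x. u x + c * v x) x = grad u x + c *\<^sub>R grad v x"
        using u v by (intro grad_P1_on_add[OF _ _ K(2)]) (auto simp: P1_space_def)
    qed
    then have ae: "AE x in lebesgue_on \<Omega>. grad (\<lambda>x. u x + c * v x) x = grad u x + c *\<^sub>R grad v x"
      using \<Omega>(1) by (simp add: AE_restrict_space_iff)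
    have "L2_inner \<Omega> (grad (\<lambda>x. u x + c * v x)) (grad w)
        = L2_inner \<Omega> (\<lambda>x. grad u x + c *\<^sub>R grad v x) (grad w)"
      unfolding L2_inner_def by (rule integral_cong_AE) (measurable, use ae in eventually_elim, simp)
    also have "\<dots> = L2_inner \<Omega> (grad u) (grad w) + c * L2_inner \<Omega> (grad v) (grad w)"
      by (intro L2_inner_add_scaleR_left bounded_measurable_integrable_inner[OF lm] bm u v w)
    finally show ?thesis .
  qed
  then show ?thesis
    unfolding psd_form_def linear_form_def using L2_inner_commute L2_inner_nonneg by blast
qed

lemma linear_form_L2_inner:
  fixes \<Omega> :: "'a::euclidean_space set"
  assumes \<Omega>: "open \<Omega>" "bounded \<Omega>" and f: "f \<in> L2_space \<Omega>"
  shows "linear_form (P1_space \<Omega> \<T>) (L2_inner \<Omega> f)"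
  unfolding linear_form_def
proof (intro ballI allI)
  fix u v :: "'a \<Rightarrow> real" and c assume "u \<in> P1_space \<Omega> \<T>" "v \<in> P1_space \<Omega> \<T>"
  then have "integrable (lebesgue_on \<Omega>) (\<lambda>x. u x \<bullet> f x)" "integrable (lebesgue_on \<Omega>) (\<lambda>x. v x \<bullet> f x)"
    using L2_space_integrable_inner[OF lmeasurable_open[OF \<Omega>(2,1)] f] P1_space_bounded_measurable[OF \<Omega>]
    unfolding inner_commute[of _ "f _"] by blast+
  from L2_inner_add_scaleR_left[OF this, of c]
  show "L2_inner \<Omega> f (\<lambda>x. u x + c * v x) = L2_inner \<Omega> f u + c * L2_inner \<Omega> f v"
    by (simp add: L2_inner_commute)
qed

section \<open>Reduction of the discrete problem to the abstract equation\<close>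

theorem theorem4p2:
  fixes \<Omega> :: "(real ^ 'd) set"
    and \<T> :: "(real ^ 'd) set set"
    and f :: "real \<Rightarrow> real ^ 'd \<Rightarrow> real"
    and Uprev :: "real ^ 'd \<Rightarrow> real"
    and k :: real
    and n :: nat
  assumes "CARD('d) = 2 \<or> CARD('d) = 3"
    and "convex_polytopal_domain \<Omega>"
    and "regular_triangulation_of \<T> (closure \<Omega>)"
    and "n \<ge> 1" and "k > 0"
    and "f (real n * k) \<in> L2_space \<Omega>"
    and "Uprev \<in> P1_space \<Omega> \<T>"
  shows "\<exists>!U. U \<in> P1_space \<Omega> \<T> \<and>
           (\<forall>\<phi>\<in>P1_space \<Omega> \<T>.
              L2_inner \<Omega> (\<lambda>x. (U x - Uprev x) / k) \<phi>
              + (1 + (L2_norm \<Omega> (grad U))\<^sup>2) * L2_inner \<Omega> (grad U) (grad \<phi>)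
              = L2_inner \<Omega> (f (real n * k)) \<phi>)"
proof -
  let ?V = "P1_space \<Omega> \<T>"
  have \<Omega>: "open \<Omega>" "bounded \<Omega>" using assms(2) by (auto simp: convex_polytopal_domain_def)
  note V = function_subspace_P1_space[of \<Omega> \<T>]
  note m = psd_form_L2_inner[OF \<Omega>, of \<T>]
  define M where "M u v = L2_inner \<Omega> u v / k" for u v :: "real ^ 'd \<Rightarrow> real"
  define A where "A u v = L2_inner \<Omega> (grad u) (grad v)" for u v :: "real ^ 'd \<Rightarrow> real"
  define l where "l \<phi> = L2_inner \<Omega> (f (real n * k)) \<phi> + M Uprev \<phi>" for \<phi>
  have M: "psd_form ?V M"
    using m assms(5) unfolding psd_form_def linear_form_def M_def
    by (simp add: add_divide_distrib)
  have A: "psd_form ?V A"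
    using psd_form_L2_inner_grad[OF \<Omega> assms(3)] unfolding A_def .
  have Mdef: "v = (\<lambda>x. 0)" if "v \<in> ?V" "M v v = 0" for v
    using P1_space_L2_definite[OF \<Omega> that(1)] that(2) assms(5) by (simp add: M_def)
  have l: "linear_form ?V l"
    using linear_form_L2_inner[OF \<Omega> assms(6), of \<T>] psd_form_lin_right[OF V M _ _ assms(7)]
    unfolding linear_form_def l_def by (simp add: algebra_simps)
  obtain P where P: "finite P" "\<And>v. v \<in> ?V \<Longrightarrow> (\<forall>p\<in>P. v p = 0) \<Longrightarrow> v = (\<lambda>x. 0)"
    using P1_space_determined[OF assms(3)] by blast
  \<comment> \<open>The contribution of \<open>Uprev\<close> moves to the right-hand side. Splitting
    the difference quotient uses linearity of the mass form, valid since \<open>U\<close>,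
    \<open>Uprev\<close> and \<open>\<phi>\<close> all lie in the space.\<close>
  have eq: "L2_inner \<Omega> (\<lambda>x. (U x - Uprev x) / k) \<phi>
        + (1 + (L2_norm \<Omega> (grad U))\<^sup>2) * L2_inner \<Omega> (grad U) (grad \<phi>)
        = L2_inner \<Omega> (f (real n * k)) \<phi> \<longleftrightarrow> M U \<phi> + (1 + A U U) * A U \<phi> = l \<phi>"
    if U: "U \<in> ?V" and \<phi>: "\<phi> \<in> ?V" for U \<phi>
  proof -
    have "L2_inner \<Omega> (\<lambda>x. (U x - Uprev x) / k) \<phi> = L2_inner \<Omega> (\<lambda>x. U x + (-1) * Uprev x) \<phi> / k"
      by (simp add: L2_inner_def)
    also have "\<dots> = M U \<phi> - M Uprev \<phi>"
      unfolding psd_formD(1)[OF m U assms(7) \<phi>] M_def by (simp add: diff_divide_distrib)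
    finally show ?thesis unfolding l_def A_def L2_norm_power2 by auto
  qed
  obtain U where U: "U \<in> ?V" "\<And>\<phi>. \<phi> \<in> ?V \<Longrightarrow> M U \<phi> + (1 + A U U) * A U \<phi> = l \<phi>"
    using Kirchhoff_exists[OF P(1) V P(2) M A Mdef l] by blast
  show ?thesis
  proof (rule ex1I[of _ U])
    fix W assume W: "W \<in> ?V \<and> (\<forall>\<phi>\<in>?V. L2_inner \<Omega> (\<lambda>x. (W x - Uprev x) / k) \<phi>
        + (1 + (L2_norm \<Omega> (grad W))\<^sup>2) * L2_inner \<Omega> (grad W) (grad \<phi>)
        = L2_inner \<Omega> (f (real n * k)) \<phi>)"
    show "W = U"
      by (rule Kirchhoff_unique[OF V M A _ _ U Mdef]) (use W eq in blast)+
  qed (use U eq in blast)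
qed

end
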